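(* For integers $\nu\ge1$ and $n\ge(\nu+1)^2$, \[ (-1)^\nu\left(pp(2n)+2\sum_{\tau=1}^{\nu}(-1)^\tau pp(2n-\tau^2)\right)=(-1)^\nu p(n)+2\,pp_e(2n) \] and \[ (-1)^\nu\left(pp(2n+1)+2\sum_{\tau=1}^{\nu}(-1)^\tau pp(2n+1-\tau^2)\right)=2\,pp_e(2n+1). \]
   Context: $p(n)$ is the number of partitions of $n$; $pp(n)$ is the number of bipartitions of $n$, i.e. pairs $(\pi_1,\pi_2)$ of partitions with $|\pi_1|+|\pi_2|=n$, where $|\pi|$ denotes the sum of parts. Definition of $M(a,m,\nu;n)$ (integers $\nu\ge0$, $1\le a<m$, $n\ge0$): for a partition $\lambda_1\ge\dots\ge\lambda_k$ of $n$ into parts $\equiv a\pmod m$, put $\ell_i=(\lambda_i-a)/m+1$ (number of boxes of the row of $\lambda_i$ in the $m$-modular Young diagram), and let $t$ be the largest integer $0\le t\le k$ with $\ell_t\ge t+\nu+2$ (height of the $(\nu+2)$-Durfee rectangle, of width $t+\nu+2$). $M(a,m,\nu;n)$ counts partitions of $n$ into parts $\equiv a\pmod m$ in which each of $a,a+m,\dots,a+m\nu$ occurs at least once and $\ell_i<t+\nu+2$ for all $i>t$. Definition (depending on $\nu$): $pp_e(n)$ counts bipartitions $(\pi_1,\pi_2)$ of $n$ such that $\pi_1$ is an arbitrary partition and, if $\alpha$ is the sum of the even parts of $\pi_2$, the odd parts of $\pi_2$ form a partition counted by $M(1,2,\nu;n-|\pi_1|-\alpha)$. *)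

theory Defs
  imports Complex_Main "HOL-Number_Theory.Cong"
begin

definition partitions :: "nat \<Rightarrow> nat list set" where
  "partitions n = {xs. sorted_wrt (\<ge>) xs \<and> (\<forall>x\<in>set xs. 0 < x) \<and> sum_list xs = n}"

definition p :: "nat \<Rightarrow> nat" where
  "p n = card (partitions n)"

definition bipartitions :: "nat \<Rightarrow> (nat list \<times> nat list) set" where
  "bipartitions n =
     {(\<pi>1, \<pi>2). \<pi>1 \<in> partitions (sum_list \<pi>1) \<and> \<pi>2 \<in> partitions (sum_list \<pi>2) \<and>
                 sum_list \<pi>1 + sum_list \<pi>2 = n}"

definition pp :: "nat \<Rightarrow> nat" where
  "pp n = card (bipartitions n)"

text \<open>Number of boxes in the row of the part \<open>x\<close> of an \<open>m\<close>-modular Young diagram; the subtraction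
  and the division are exact whenever \<open>x\<close> is a positive number congruent to \<open>a\<close> modulo \<open>m\<close> and
  \<open>1 \<le> a < m\<close>.\<close>

definition row_length :: "nat \<Rightarrow> nat \<Rightarrow> nat \<Rightarrow> nat" where
  "row_length a m x = (x - a) div m + 1"

text \<open>Parts are numbered from 1 in the mathematics, so the \<open>i\<close>-th part is \<open>xs ! (i - 1)\<close>. The
  value \<open>t = 0\<close> is always admissible (empty rectangle), so the maximum is over a nonempty finite
  set.\<close>

definition durfee_height :: "nat \<Rightarrow> nat \<Rightarrow> nat \<Rightarrow> nat list \<Rightarrow> nat" where
  "durfee_height a m \<nu> xs =
     Max {t. t \<le> length xs \<and> (t = 0 \<or> row_length a m (xs ! (t - 1)) \<ge> t + \<nu> + 2)}"

definition M_partitions :: "nat \<Rightarrow> nat \<Rightarrow> nat \<Rightarrow> nat \<Rightarrow> nat list set" where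
  "M_partitions a m \<nu> n =
     {xs \<in> partitions n.
        (\<forall>x\<in>set xs. [x = a] (mod m)) \<and>
        (\<forall>j\<le>\<nu>. a + m * j \<in> set xs) \<and>
        (\<forall>i. durfee_height a m \<nu> xs < i \<and> i \<le> length xs \<longrightarrow>
             row_length a m (xs ! (i - 1)) < durfee_height a m \<nu> xs + \<nu> + 2)}"

definition pp_e :: "nat \<Rightarrow> nat \<Rightarrow> nat" where
  "pp_e \<nu> n =
     card {(\<pi>1, \<pi>2) \<in> bipartitions n.
             filter odd \<pi>2 \<in>
               M_partitions 1 2 \<nu> (n - sum_list \<pi>1 - sum_list (filter even \<pi>2))}"

text \<open>The sets counted above are finite, so \<open>card\<close> never takes its default value.\<close>

lemma finite_partitions: "finite (partitions n)"
proof (rule finite_subset)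
  have len: "length xs \<le> sum_list xs" if "\<forall>x\<in>set xs. 0 < x" for xs :: "nat list"
    using that by (induction xs) auto
  show "partitions n \<subseteq> {xs. set xs \<subseteq> {..n} \<and> length xs \<le> n}"
    using len by (auto simp: partitions_def dest: member_le_sum_list)
  show "finite {xs. set xs \<subseteq> {..n} \<and> length xs \<le> n}"
    by (rule finite_lists_length_le) simp
qed

lemma finite_bipartitions: "finite (bipartitions n)"
proof (rule finite_subset)
  show "bipartitions n \<subseteq> (\<Union>i\<le>n. partitions i) \<times> (\<Union>j\<le>n. partitions j)"
  proof
    fix z assume "z \<in> bipartitions n"
    then have "fst z \<in> partitions (sum_list (fst z))" "snd z \<in> partitions (sum_list (snd z))"
      "sum_list (fst z) \<in> {..n}" "sum_list (snd z) \<in> {..n}"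
      by (auto simp: bipartitions_def)
    then show "z \<in> (\<Union>i\<le>n. partitions i) \<times> (\<Union>j\<le>n. partitions j)"
      unfolding mem_Times_iff by blast
  qed
  show "finite ((\<Union>i\<le>n. partitions i) \<times> (\<Union>j\<le>n. partitions j))"
    by (simp add: finite_partitions)
qed

end

theory Submission
  imports Defs "HOL-Computational_Algebra.Formal_Power_Series" "HOL-Library.Multiset"
begin

text \<open>
  Let \<open>P\<close>, \<open>E\<close>, \<open>O\<close> be the generating functions of partitions with arbitrary, even and odd parts, so
  \<open>P = E O\<close>, and let \<open>F\<^sub>N\<close> enumerate the partitions into odd parts in which, for some \<open>t\<close>, exactly \<open>t\<close>
  parts are at least \<open>2 (t + N) + 1\<close>. Removing one copy of each of \<open>1, 3, \<dots>, 2 \<nu> + 1\<close> shows that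
  \<open>P E q\<^bsup>N\<^sup>2\<^esup> F\<^sub>N\<close> with \<open>N = \<nu> + 1\<close> is the generating function of \<open>pp\<^sub>e\<close>. Since
  \<open>F\<^sub>N = \<Sum>\<^sub>t q\<^bsup>t(2t+2N+1)\<^esup> / ((q\<^sup>2;q\<^sup>2)\<^sub>t (q;q\<^sup>2)\<^bsub>t+N\<^esub>)\<close>, one has
  \<open>F\<^sub>N + q\<^bsup>2N+1\<^esup> F\<^bsub>N+1\<^esub> = O\<close>: the left side does not depend on \<open>N\<close> by a telescoping certificate, and
  it tends to \<open>O\<close> as \<open>N\<close> grows. Interleaving the series of \<open>F\<^sub>0\<close> and \<open>q F\<^sub>1\<close> gives Euler's series
  \<open>F\<^sub>0 - q F\<^sub>1 = \<Sum>\<^sub>k (-1)\<^sup>k q\<^bsup>k(k+1)/2\<^esup> / (q;q)\<^sub>k = 1 / P\<close>. Hence \<open>Y\<^sub>N = P E q\<^bsup>N\<^sup>2\<^esup> F\<^sub>N\<close> satisfies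
  \<open>Y\<^sub>N + Y\<^bsub>N+1\<^esub> = q\<^bsup>N\<^sup>2\<^esup> P\<^sup>2\<close> and \<open>Y\<^sub>0 - Y\<^sub>1 = E\<close>, and the alternating sum telescopes.
\<close>

section \<open>Generating functions of weighted sets\<close>

unbundle fps_syntax

definition gf :: "('a \<Rightarrow> nat) \<Rightarrow> 'a set \<Rightarrow> int fps" where
  "gf w S = Abs_fps (\<lambda>n. int (card {x \<in> S. w x = n}))"

lemma gf_nth [simp]: "gf w S $ n = int (card {x \<in> S. w x = n})"
  by (simp add: gf_def)

lemma gf_bij_shift:
  assumes f: "bij_betw f S T" and w: "\<And>x. x \<in> S \<Longrightarrow> w' (f x) = w x + c"
  shows "gf w' T = fps_X ^ c * gf w S"
proof (rule fps_ext)
  fix n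
  have T: "T = f ` S" using f by (simp add: bij_betw_def)
  show "gf w' T $ n = (fps_X ^ c * gf w S) $ n"
  proof (cases "n < c")
    case True
    then have "{x \<in> T. w' x = n} = {}" by (auto simp: T w)
    then show ?thesis using True by (simp only: gf_nth fps_X_power_mult_nth) simp
  next
    case False
    have "bij_betw f {x \<in> S. w x = n - c} {x \<in> T. w' x = n}"
      using f False by (auto simp: bij_betw_def T w inj_on_def)
    then show ?thesis
      using False by (simp add: fps_X_power_mult_nth bij_betw_same_card)
  qed
qed

lemma gf_bij:
  assumes "bij_betw f S T" and "\<And>x. x \<in> S \<Longrightarrow> w' (f x) = w x"
  shows "gf w' T = gf w S"
  using gf_bij_shift[of f S T w' w 0] assms by simp

text \<open>An infinite fibre would count as 0 under \<open>card\<close>, so finiteness of the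
  fibres is assumed here and in \<open>gf_Times\<close>. Transport along a bijection, as in
  \<open>gf_bij_shift\<close>, is safe in either case.\<close>

lemma gf_Un:
  assumes "S \<inter> T = {}" and "\<And>n. finite {x \<in> S. w x = n}" and "\<And>n. finite {x \<in> T. w x = n}"
  shows "gf w (S \<union> T) = gf w S + gf w T"
proof (rule fps_ext)
  fix n
  have "{x \<in> S \<union> T. w x = n} = {x \<in> S. w x = n} \<union> {x \<in> T. w x = n}" by auto
  then show "gf w (S \<union> T) $ n = (gf w S + gf w T) $ n"
    using assms by (simp add: card_Un_disjoint disjoint_iff)
qed

lemma gf_Times:
  assumes "\<And>n. finite {x \<in> S. w x = n}" and "\<And>n. finite {x \<in> T. w' x = n}"
  shows "gf (\<lambda>(x, y). w x + w' y) (S \<times> T) = gf w S * gf w' T"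
proof (rule fps_ext)
  fix n
  have "{z \<in> S \<times> T. (case z of (x, y) \<Rightarrow> w x + w' y) = n} =
      (\<Union>i\<in>{0..n}. {x \<in> S. w x = i} \<times> {y \<in> T. w' y = n - i})"
    by auto
  moreover have "card (\<Union>i\<in>{0..n}. {x \<in> S. w x = i} \<times> {y \<in> T. w' y = n - i}) =
      (\<Sum>i=0..n. card ({x \<in> S. w x = i} \<times> {y \<in> T. w' y = n - i}))"
    using assms by (intro card_UN_disjoint) auto
  ultimately show "gf (\<lambda>(x, y). w x + w' y) (S \<times> T) $ n = (gf w S * gf w' T) $ n"
    by (simp add: fps_mult_nth card_cartesian_product)
qed

subsection \<open>Congruences modulo powers of the indeterminate\<close>

lemma fps_X_power_dvd_iff: "fps_X ^ k dvd f \<longleftrightarrow> (\<forall>n<k. f $ n = 0)" for f :: "'a::comm_ring_1 fps"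
proof
  assume "\<forall>n<k. f $ n = 0"
  then have "f = fps_X ^ k * fps_shift k f"
    by (intro fps_ext) (simp add: fps_X_power_mult_nth)
  then show "fps_X ^ k dvd f" by (metis dvd_triv_left)
qed (auto simp: fps_X_power_mult_nth elim!: dvdE)

text \<open>This replaces convergence: every infinite sum below is treated as a finite partial sum
  modulo \<open>fps_X ^ K\<close>, for arbitrary \<open>K\<close>.\<close>

lemma fps_eq_if_cong:
  fixes f g :: "'a::comm_ring_1 fps"
  assumes "\<And>k. fps_X ^ k dvd f - g"
  shows "f = g"
proof (rule fps_ext)
  fix n
  show "f $ n = g $ n" using assms[of "Suc n"] unfolding fps_X_power_dvd_iff by simp
qed

lemma dvd_diff_trans: "d dvd x - y \<Longrightarrow> d dvd y - z \<Longrightarrow> d dvd x - z" for d :: "'a::comm_ring_1"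
  using dvd_add[of d "x - y" "y - z"] by simp

subsection \<open>Multisets with parts in a given set\<close>

text \<open>Multisets stand for partitions because adding, removing and separating parts are then
  plain multiset operations; \<open>bij_mset_part_lists\<close> leads back to the decreasing
  lists.\<close>

definition parts :: "nat set \<Rightarrow> nat multiset set" where
  "parts I = {M. set_mset M \<subseteq> I}"

abbreviation GF :: "nat set \<Rightarrow> int fps" where
  "GF I \<equiv> gf sum_mset (parts I)"

definition part_lists :: "nat list set" where
  "part_lists = {xs. sorted_wrt (\<ge>) xs \<and> (\<forall>x\<in>set xs. 0 < x)}"

lemma partitions_eq: "partitions n = {xs \<in> part_lists. sum_list xs = n}"
  by (auto simp: partitions_def part_lists_def)

lemma bij_mset_part_lists: "bij_betw mset part_lists (parts {0<..})"
proof (rule bij_betw_byWitness[where f' = "\<lambda>M. rev (sorted_list_of_multiset M)"])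
  show "\<forall>xs\<in>part_lists. rev (sorted_list_of_multiset (mset xs)) = xs"
  proof
    fix xs :: "nat list" assume "xs \<in> part_lists"
    then have "sorted (rev xs)" by (simp add: part_lists_def sorted_wrt_rev)
    then have "sort xs = rev xs" by (intro properties_for_sort) auto
    then show "rev (sorted_list_of_multiset (mset xs)) = xs" by simp
  qed
  show "mset ` part_lists \<subseteq> parts {0<..}"
    by (auto simp: part_lists_def parts_def)
  show "(\<lambda>M. rev (sorted_list_of_multiset M)) ` parts {0<..} \<subseteq> part_lists"
    by (auto simp: part_lists_def parts_def sorted_wrt_rev)
qed auto

lemma finite_part_lists: "finite {xs \<in> part_lists. sum_list xs = n}"
  using finite_partitions[of n] by (simp add: partitions_eq)

lemma finite_parts:
  assumes "S \<subseteq> parts {0<..}"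
  shows "finite {M \<in> S. sum_mset M = n}"
proof (rule finite_subset)
  show "{M \<in> S. sum_mset M = n} \<subseteq> mset ` {xs \<in> part_lists. sum_list xs = n}"
  proof clarify
    fix M assume "M \<in> S"
    then have "M \<in> mset ` part_lists"
      using assms bij_mset_part_lists by (auto simp: bij_betw_def)
    then show "M \<in> mset ` {xs \<in> part_lists. sum_list xs = sum_mset M}"
      by (auto simp: sum_mset_sum_list)
  qed
qed (simp add: finite_part_lists)

lemma parts_mono: "I \<subseteq> J \<Longrightarrow> parts I \<subseteq> parts J"
  by (auto simp: parts_def)

text \<open>The sets \<open>S\<close> and \<open>T\<close> carry further conditions on the two
  pieces. This single splitting yields the product rule \<open>GF_Un\<close>, the decomposition
  along a Durfee rectangle, and the separation of even and odd parts in \<open>pp_e\<close>.\<close>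

lemma bij_betw_parts_Un:
  assumes "I \<inter> J = {}" "S \<subseteq> parts I" "T \<subseteq> parts J"
  shows "bij_betw (\<lambda>(A, B). A + B) (S \<times> T)
    {M \<in> parts (I \<union> J). filter_mset (\<lambda>x. x \<in> I) M \<in> S \<and> filter_mset (\<lambda>x. x \<in> J) M \<in> T}"
proof (rule bij_betw_byWitness[where
      f' = "\<lambda>M. (filter_mset (\<lambda>x. x \<in> I) M, filter_mset (\<lambda>x. x \<in> J) M)"])
  have *: "filter_mset (\<lambda>x. x \<in> I) A = A" "filter_mset (\<lambda>x. x \<in> J) A = {#}" if "A \<in> parts I" for A
    using that assms(1) by (auto simp: parts_def filter_mset_eq_conv)
  have **: "filter_mset (\<lambda>x. x \<in> J) A = A" "filter_mset (\<lambda>x. x \<in> I) A = {#}" if "A \<in> parts J" for A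
    using that assms(1) by (auto simp: parts_def filter_mset_eq_conv)
  have ***: "filter_mset (\<lambda>x. x \<in> I) (A + B) = A" "filter_mset (\<lambda>x. x \<in> J) (A + B) = B"
    if "A \<in> S" "B \<in> T" for A B
  proof -
    have "A \<in> parts I" "B \<in> parts J" using that assms(2,3) by auto
    then show "filter_mset (\<lambda>x. x \<in> I) (A + B) = A" "filter_mset (\<lambda>x. x \<in> J) (A + B) = B"
      by (simp_all only: filter_union_mset * ** add_0_left add_0_right)
  qed
  show "\<forall>a\<in>S \<times> T. (filter_mset (\<lambda>x. x \<in> I) (case a of (A, B) \<Rightarrow> A + B),
      filter_mset (\<lambda>x. x \<in> J) (case a of (A, B) \<Rightarrow> A + B)) = a"
    using *** by auto
  show "(\<lambda>(A, B). A + B) ` (S \<times> T) \<subseteq> {M \<in> parts (I \<union> J).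
      filter_mset (\<lambda>x. x \<in> I) M \<in> S \<and> filter_mset (\<lambda>x. x \<in> J) M \<in> T}"
  proof clarify
    fix A B assume "A \<in> S" "B \<in> T"
    moreover from this have "A + B \<in> parts (I \<union> J)"
      using assms(2,3) by (auto simp: parts_def)
    ultimately show "A + B \<in> parts (I \<union> J) \<and> filter_mset (\<lambda>x. x \<in> I) (A + B) \<in> S \<and>
        filter_mset (\<lambda>x. x \<in> J) (A + B) \<in> T"
      by (simp only: ***)
  qed
  have "filter_mset (\<lambda>x. x \<in> I) M + filter_mset (\<lambda>x. x \<in> J) M = M" if "M \<in> parts (I \<union> J)" for M
    using that assms(1) by (auto simp: multiset_eq_iff parts_def) (metis IntI Un_iff empty_iff not_in_iff subsetD)+
  then show "\<forall>M\<in>{M \<in> parts (I \<union> J).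
      filter_mset (\<lambda>x. x \<in> I) M \<in> S \<and> filter_mset (\<lambda>x. x \<in> J) M \<in> T}.
      (case (filter_mset (\<lambda>x. x \<in> I) M, filter_mset (\<lambda>x. x \<in> J) M) of (A, B) \<Rightarrow> A + B) = M"
    by auto
qed auto

lemma gf_parts_Un:
  assumes "I \<inter> J = {}" "S \<subseteq> parts I" "T \<subseteq> parts J" "I \<union> J \<subseteq> {0<..}"
  shows "gf sum_mset {M \<in> parts (I \<union> J). filter_mset (\<lambda>x. x \<in> I) M \<in> S \<and>
    filter_mset (\<lambda>x. x \<in> J) M \<in> T} = gf sum_mset S * gf sum_mset T"
proof -
  have "S \<subseteq> parts {0<..}" "T \<subseteq> parts {0<..}"
    using assms parts_mono[of I "{0<..}"] parts_mono[of J "{0<..}"] by auto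
  then show ?thesis
    by (subst gf_Times[symmetric])
      (auto intro!: gf_bij[OF bij_betw_parts_Un] finite_parts assms)
qed

lemma GF_Un:
  assumes "I \<inter> J = {}" "I \<union> J \<subseteq> {0<..}"
  shows "GF (I \<union> J) = GF I * GF J"
proof -
  have "{M \<in> parts (I \<union> J). filter_mset (\<lambda>x. x \<in> I) M \<in> parts I \<and>
      filter_mset (\<lambda>x. x \<in> J) M \<in> parts J} = parts (I \<union> J)"
    by (auto simp: parts_def)
  then show ?thesis using gf_parts_Un[of I J "parts I" "parts J"] assms by simp
qed

text \<open>A multiset either avoids \<open>i\<close> or arises by adding one copy of
  \<open>i\<close> to another multiset of the same kind. Keeping \<open>1 - fps_X ^ i\<close> as a
  factor avoids inverses of power series.\<close>

lemma GF_insert: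
  assumes "i \<notin> I" "insert i I \<subseteq> {0<..}"
  shows "(1 - fps_X ^ i) * GF (insert i I) = GF I"
proof -
  have "bij_betw (add_mset i) (parts (insert i I)) (add_mset i ` parts (insert i I))"
    by (auto simp: bij_betw_def inj_on_def)
  then have 1: "gf sum_mset (add_mset i ` parts (insert i I)) = fps_X ^ i * GF (insert i I)"
    by (rule gf_bij_shift) simp
  have 2: "parts (insert i I) = parts I \<union> add_mset i ` parts (insert i I)"
  proof (intro equalityI subsetI)
    fix M assume M: "M \<in> parts (insert i I)"
    show "M \<in> parts I \<union> add_mset i ` parts (insert i I)"
    proof (cases "i \<in># M")
      case True
      then have "M = add_mset i (M - {#i#})" by simp
      moreover have "M - {#i#} \<in> parts (insert i I)"
        using M by (auto simp: parts_def dest: in_diffD)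
      ultimately show ?thesis by blast
    qed (use M in \<open>auto simp: parts_def\<close>)
  qed (auto simp: parts_def)
  have "GF (insert i I) = GF I + gf sum_mset (add_mset i ` parts (insert i I))"
  proof (subst 2, rule gf_Un)
    show "parts I \<inter> add_mset i ` parts (insert i I) = {}" using assms by (auto simp: parts_def)
    have "parts (insert i I) \<subseteq> parts {0<..}" using assms(2) by (rule parts_mono)
    then show "finite {x \<in> parts I. sum_mset x = n}"
      "finite {x \<in> add_mset i ` parts (insert i I). sum_mset x = n}" for n
      using 2 by (auto intro!: finite_parts)
  qed
  then show ?thesis using 1 by (simp add: algebra_simps)
qed

lemma GF_empty [simp]: "GF {} = 1"
proof -
  have "{M \<in> parts {}. sum_mset M = n} = (if n = 0 then {{#}} else {})" for n
    by (auto simp: parts_def)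
  then show ?thesis by (intro fps_ext) simp
qed

text \<open>A nonempty multiset over \<open>I\<close> has sum at least \<open>k\<close>, so in
  degrees below \<open>k\<close> only the empty one is counted.\<close>

lemma GF_cong_1:
  assumes "I \<subseteq> {k..}" "0 \<notin> I"
  shows "fps_X ^ k dvd GF I - 1"
proof -
  have "{M \<in> parts I. sum_mset M = n} = (if n = 0 then {{#}} else {})" if "n < k" for n
  proof -
    have "M = {#}" if "M \<in> parts I" "sum_mset M < k" for M
    proof (rule ccontr)
      assume "M \<noteq> {#}"
      then obtain x where x: "x \<in># M" by blast
      then have "x \<le> sum_mset M" by (metis le_add1 insert_DiffM sum_mset.add_mset)
      then show False using x that assms(1) by (auto simp: parts_def)
    qed
    then have "M \<in> parts I \<and> sum_mset M = n \<longleftrightarrow> M = {#} \<and> n = 0" for M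
      using that by (cases "M = {#}") (auto simp: parts_def)
    then show ?thesis by auto
  qed
  then show ?thesis by (simp add: fps_X_power_dvd_iff)
qed


subsection \<open>Generalized Durfee rectangles\<close>

text \<open>With q for \<open>fps_X\<close>, \<open>odd_GF k\<close> is 1/(q;q^2)_k and
  \<open>even_GF k\<close> is 1/(q^2;q^2)_k; the two \<open>Suc\<close> lemmas below are their
  defining product recursions.\<close>

abbreviation odd_GF :: "nat \<Rightarrow> int fps" where
  "odd_GF k \<equiv> GF {x. odd x \<and> x < 2 * k}"

abbreviation even_GF :: "nat \<Rightarrow> int fps" where
  "even_GF k \<equiv> GF {x. even x \<and> 0 < x \<and> x \<le> 2 * k}"

lemma odd_GF_Suc: "(1 - fps_X ^ (2 * k + 1)) * odd_GF (Suc k) = odd_GF k"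
proof -
  have *: "{x. odd x \<and> x < 2 * Suc k} = insert (2 * k + 1) {x. odd x \<and> x < 2 * k}"
    by (auto; presburger)
  show ?thesis unfolding * by (rule GF_insert) (auto intro: odd_pos)
qed

lemma even_GF_Suc: "(1 - fps_X ^ (2 * k + 2)) * even_GF (Suc k) = even_GF k"
proof -
  have *: "{x. even x \<and> 0 < x \<and> x \<le> 2 * Suc k} =
      insert (2 * k + 2) {x. even x \<and> 0 < x \<and> x \<le> 2 * k}"
    by (auto; presburger)
  show ?thesis unfolding * by (rule GF_insert) auto
qed

lemma even_GF_0: "even_GF 0 = 1"
proof -
  have *: "{x. even x \<and> 0 < x \<and> x \<le> 2 * (0::nat)} = {}" by auto
  show ?thesis unfolding * by (rule GF_empty)
qed

lemma one_minus_fps_X_power_neq_0: "1 - fps_X ^ Suc m \<noteq> (0 :: int fps)"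
proof
  assume "1 - fps_X ^ Suc m = (0 :: int fps)"
  then have "(1 - fps_X ^ Suc m) $ 0 = (0 :: int fps) $ 0" by (rule arg_cong)
  then show False by simp
qed

text \<open>Induction on \<open>t\<close> in place of conjugating a diagram. Among
  \<open>t + 1\<close> odd parts of size at least \<open>2 * k + 1\<close>, either the least value
  occurs and one copy is removed, or subtracting 2 from every part is a bijection back to the same
  set. This gives (1 - q^(2t+2)) G_(t+1) = q^(2k+1) G_t.\<close>

lemma gf_odd_parts_of_size:
  "gf sum_mset {M \<in> parts {x. odd x \<and> 2 * k + 1 \<le> x}. size M = t} =
    fps_X ^ (t * (2 * k + 1)) * even_GF t"
proof (induction t)
  case 0
  have "{M \<in> parts {x. odd x \<and> 2 * k + 1 \<le> x}. size M = 0} = parts {}"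
    by (auto simp: parts_def)
  then show ?case using GF_empty by (simp add: even_GF_0[simplified])
next
  case (Suc t)
  define S where "S j t = {M \<in> parts {x. odd x \<and> 2 * j + 1 \<le> x}. size M = t}" for j t :: nat
  have S_pos: "S j t \<subseteq> parts {0<..}" for j t
    by (auto simp: S_def parts_def intro: odd_pos)
  have sum: "sum_mset (image_mset (\<lambda>x. x + 2) M) = sum_mset M + 2 * size M" for M :: "nat multiset"
    by (induction M) auto
  have "bij_betw (image_mset (\<lambda>x. x + 2)) (S k (Suc t)) (S (Suc k) (Suc t))"
  proof (rule bij_betw_byWitness[where f' = "image_mset (\<lambda>x. x - 2)"])
    have "image_mset (\<lambda>x. x - 2 + 2) M = image_mset (\<lambda>x. x) M" if "M \<in> S (Suc k) (Suc t)" for M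
      using that by (intro image_mset_cong) (auto simp: S_def parts_def)
    then show "\<forall>M\<in>S (Suc k) (Suc t). image_mset (\<lambda>x. x + 2) (image_mset (\<lambda>x. x - 2) M) = M"
      by (simp add: multiset.map_comp o_def)
    show "image_mset (\<lambda>x. x - 2) ` S (Suc k) (Suc t) \<subseteq> S k (Suc t)"
      by (fastforce simp: S_def parts_def)
    show "image_mset (\<lambda>x. x + 2) ` S k (Suc t) \<subseteq> S (Suc k) (Suc t)"
      by (fastforce simp: S_def parts_def)
  qed (auto simp: multiset.map_comp o_def)
  then have shift: "gf sum_mset (S (Suc k) (Suc t)) = fps_X ^ (2 * Suc t) * gf sum_mset (S k (Suc t))"
    by (rule gf_bij_shift) (simp only: sum, simp add: S_def)
  have "bij_betw (add_mset (2 * k + 1)) (S k t) (add_mset (2 * k + 1) ` S k t)"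
    by (auto simp: bij_betw_def inj_on_def)
  then have add: "gf sum_mset (add_mset (2 * k + 1) ` S k t) = fps_X ^ (2 * k + 1) * gf sum_mset (S k t)"
    by (rule gf_bij_shift) simp
  have split: "S k (Suc t) = S (Suc k) (Suc t) \<union> add_mset (2 * k + 1) ` S k t"
  proof (intro equalityI subsetI)
    fix M assume M: "M \<in> S k (Suc t)"
    show "M \<in> S (Suc k) (Suc t) \<union> add_mset (2 * k + 1) ` S k t"
    proof (cases "2 * k + 1 \<in># M")
      case True
      then have "M = add_mset (2 * k + 1) (M - {#2 * k + 1#})" by simp
      moreover have "M - {#2 * k + 1#} \<in> S k t"
        using M True by (auto simp: S_def parts_def size_Diff_singleton dest: in_diffD)
      ultimately show ?thesis by blast
    next
      case False
      have "2 * Suc k + 1 \<le> x" if "x \<in># M" for x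
      proof -
        have "odd x" "2 * k + 1 \<le> x" "x \<noteq> 2 * k + 1"
          using that M False by (auto simp: S_def parts_def)
        then show ?thesis by presburger
      qed
      then show ?thesis using M by (auto simp: S_def parts_def)
    qed
  qed (auto simp: S_def parts_def)
  have "gf sum_mset (S k (Suc t)) =
      gf sum_mset (S (Suc k) (Suc t)) + gf sum_mset (add_mset (2 * k + 1) ` S k t)"
  proof (subst split, rule gf_Un)
    show "S (Suc k) (Suc t) \<inter> add_mset (2 * k + 1) ` S k t = {}"
      by (auto simp: S_def parts_def)
    show "finite {x \<in> S (Suc k) (Suc t). sum_mset x = n}"
      "finite {x \<in> add_mset (2 * k + 1) ` S k t. sum_mset x = n}" for n
      using split S_pos[of k "Suc t"] by (auto intro!: finite_parts)
  qed
  then have "(1 - fps_X ^ (2 * Suc t)) * gf sum_mset (S k (Suc t)) =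
      fps_X ^ (2 * k + 1) * gf sum_mset (S k t)"
    using shift add by (simp add: algebra_simps)
  also have "gf sum_mset (S k t) = fps_X ^ (t * (2 * k + 1)) * even_GF t"
    using Suc.IH by (simp add: S_def)
  also have "even_GF t = (1 - fps_X ^ (2 * Suc t)) * even_GF (Suc t)"
    using even_GF_Suc[of t] by simp
  finally have "(1 - fps_X ^ (2 * Suc t)) * gf sum_mset (S k (Suc t)) =
      (1 - fps_X ^ (2 * Suc t)) * (fps_X ^ (Suc t * (2 * k + 1)) * even_GF (Suc t))"
    by (simp add: power_add algebra_simps)
  moreover have "1 - fps_X ^ (2 * Suc t) \<noteq> (0 :: int fps)"
    using one_minus_fps_X_power_neq_0[of "2 * t + 1"] by simp
  ultimately have "gf sum_mset (S k (Suc t)) = fps_X ^ (Suc t * (2 * k + 1)) * even_GF (Suc t)"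
    by (simp only: mult_cancel_left) simp
  then show ?case by (simp only: S_def)
qed

text \<open>A part 2l - 1 has a row of l boxes, so the threshold says that exactly \<open>t\<close>
  rows have at least \<open>t + N + 1\<close> boxes. Some partitions into odd parts satisfy this for
  no \<open>t\<close>; \<open>durfee_GF_recurrence\<close> below accounts for them.\<close>

definition durfee_set :: "nat \<Rightarrow> nat \<Rightarrow> nat multiset set" where
  "durfee_set N t =
    {M \<in> parts {x. odd x}. size (filter_mset (\<lambda>x. 2 * (t + N) + 1 \<le> x) M) = t}"

definition durfee_GF :: "nat \<Rightarrow> int fps" where
  "durfee_GF N = gf sum_mset (\<Union>t. durfee_set N t)"

definition durfee_term :: "nat \<Rightarrow> nat \<Rightarrow> int fps" where
  "durfee_term N t = fps_X ^ (t * (2 * (t + N) + 1)) * even_GF t * odd_GF (t + N)"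

text \<open>The \<open>t\<close> parts above the threshold and the odd parts below
  \<open>2 * (t + N)\<close> are chosen independently.\<close>

lemma gf_durfee_set: "gf sum_mset (durfee_set N t) = durfee_term N t"
proof -
  define I where "I = {x. odd x \<and> 2 * (t + N) + 1 \<le> x}"
  define J where "J = {x. odd x \<and> x < 2 * (t + N)}"
  have IJ: "I \<union> J = {x. odd x}" unfolding I_def J_def by (auto; presburger)
  have "filter_mset (\<lambda>x. x \<in> I) M = filter_mset (\<lambda>x. 2 * (t + N) + 1 \<le> x) M"
    if "M \<in> parts {x. odd x}" for M
    using that by (intro filter_mset_cong) (auto simp: I_def parts_def)
  then have "{M \<in> parts (I \<union> J). filter_mset (\<lambda>x. x \<in> I) M \<in> {M \<in> parts I. size M = t} \<and>
      filter_mset (\<lambda>x. x \<in> J) M \<in> parts J} = durfee_set N t"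
    unfolding IJ by (auto simp: durfee_set_def parts_def I_def)
  moreover have "gf sum_mset {M \<in> parts (I \<union> J). filter_mset (\<lambda>x. x \<in> I) M \<in> {M \<in> parts I. size M = t} \<and>
      filter_mset (\<lambda>x. x \<in> J) M \<in> parts J} = gf sum_mset {M \<in> parts I. size M = t} * GF J"
    by (rule gf_parts_Un) (auto simp: I_def J_def odd_pos)
  ultimately show ?thesis
    unfolding I_def J_def gf_odd_parts_of_size by (simp add: durfee_term_def)
qed

text \<open>The number of parts above the threshold is weakly decreasing in \<open>t\<close>, so it
  can equal \<open>t\<close> only once.\<close>

lemma durfee_set_disjoint:
  assumes "M \<in> durfee_set N s" "M \<in> durfee_set N t"
  shows "s = t"
proof -
  have "size (filter_mset (\<lambda>x. 2 * (b + N) + 1 \<le> x) M) \<le> size (filter_mset (\<lambda>x. 2 * (a + N) + 1 \<le> x) M)"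
    if "a \<le> b" for a b
    using that by (intro size_mset_mono filter_mset_mono_strong) auto
  from this[of s t] this[of t s] show ?thesis
    using assms by (fastforce simp: durfee_set_def)
qed

lemma size_le_sum_mset: "size M \<le> sum_mset M" if "M \<in> parts {0<..}"
  using that by (induction M) (auto simp: parts_def)

lemma durfee_set_subset: "durfee_set N t \<subseteq> parts {0<..}"
  by (auto simp: durfee_set_def parts_def intro: odd_pos)

text \<open>A member of \<open>durfee_set N t\<close> has at least \<open>t\<close> positive parts,
  hence sum at least \<open>t\<close>; indices from \<open>K\<close> on cannot affect degrees below
  \<open>K\<close>.\<close>

lemma durfee_GF_cong: "fps_X ^ K dvd durfee_GF N - (\<Sum>t<K. durfee_term N t)"
proof -
  have "durfee_GF N $ n = (\<Sum>t<K. durfee_term N t) $ n" if "n < K" for n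
  proof -
    have "t \<le> sum_mset M" if "M \<in> durfee_set N t" for M t
    proof -
      have "t \<le> size M" using that size_filter_mset_lesseq[of "\<lambda>x. 2 * (t + N) + 1 \<le> x" M]
        unfolding durfee_set_def by simp
      also have "\<dots> \<le> sum_mset M" using that durfee_set_subset by (intro size_le_sum_mset) auto
      finally show ?thesis .
    qed
    then have "{M \<in> (\<Union>t. durfee_set N t). sum_mset M = n} =
        (\<Union>t\<in>{..<K}. {M \<in> durfee_set N t. sum_mset M = n})"
      using that by fastforce
    moreover have "card (\<Union>t\<in>{..<K}. {M \<in> durfee_set N t. sum_mset M = n}) =
        (\<Sum>t<K. card {M \<in> durfee_set N t. sum_mset M = n})"
      using durfee_set_disjoint
      by (intro card_UN_disjoint) (auto intro!: finite_parts durfee_set_subset)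
    ultimately show ?thesis
      by (simp add: durfee_GF_def fps_sum_nth flip: gf_durfee_set)
  qed
  then show ?thesis by (simp add: fps_X_power_dvd_iff)
qed


section \<open>The recurrence in \<open>N\<close>\<close>

definition durfee_pair :: "nat \<Rightarrow> nat \<Rightarrow> int fps" where
  "durfee_pair N t = fps_X ^ (t * (2 * (t + N) + 1)) * even_GF t * odd_GF (Suc (t + N))"

text \<open>Over the common factor \<open>odd_GF (Suc (t + N))\<close> the two summands carry 1 -
  q^v and q^v, where v = 2(t+N) + 1.\<close>

lemma durfee_term_add:
  "durfee_term N t + fps_X ^ (2 * N + 1) * durfee_term (Suc N) t = durfee_pair N t"
proof -
  have e: "t * (2 * (t + Suc N) + 1) + (2 * N + 1) = t * (2 * (t + N) + 1) + (2 * (t + N) + 1)"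
    by (simp add: algebra_simps)
  have "fps_X ^ (2 * N + 1) * durfee_term (Suc N) t =
      fps_X ^ (t * (2 * (t + Suc N) + 1) + (2 * N + 1)) * even_GF t * odd_GF (Suc (t + N))"
    by (simp add: durfee_term_def power_add algebra_simps)
  also have "\<dots> = fps_X ^ (t * (2 * (t + N) + 1)) * fps_X ^ (2 * (t + N) + 1) *
      even_GF t * odd_GF (Suc (t + N))"
    by (simp only: e power_add)
  finally have 1: "fps_X ^ (2 * N + 1) * durfee_term (Suc N) t = \<dots>" .
  show ?thesis
    unfolding 1 durfee_term_def[of N t] durfee_pair_def odd_GF_Suc[of "t + N", symmetric] by algebra
qed

text \<open>A WZ certificate: its differences in \<open>t\<close> are the differences of \<open>durfee_pair\<close> in \<open>N\<close>. It
  vanishes at \<open>t = 0\<close> and is divisible by \<open>q\<^sup>t\<close>.\<close>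

definition durfee_cert :: "nat \<Rightarrow> nat \<Rightarrow> int fps" where
  "durfee_cert N t =
    fps_X ^ (t * (2 * (t + N) + 1)) * (1 - fps_X ^ (2 * t)) * even_GF t * odd_GF (Suc (t + N))"

lemma durfee_pair_diff:
  "durfee_pair N t - durfee_pair (Suc N) t = durfee_cert N t - durfee_cert N (Suc t)"
proof -
  define v where "v = 2 * (t + N) + 1"
  have q: "odd_GF (Suc (t + N)) = (1 - fps_X ^ (v + 2)) * odd_GF (Suc (Suc (t + N)))"
    using odd_GF_Suc[of "Suc (t + N)"] by (simp add: v_def)
  have 1: "durfee_pair N t = fps_X ^ (t * v) * even_GF t * odd_GF (Suc (t + N))"
    by (simp add: durfee_pair_def v_def)
  have "t * (2 * (t + Suc N) + 1) = t * v + 2 * t" by (simp add: v_def algebra_simps)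
  then have 2: "durfee_pair (Suc N) t =
      fps_X ^ (t * v) * fps_X ^ (2 * t) * even_GF t * odd_GF (Suc (Suc (t + N)))"
    unfolding durfee_pair_def by (simp only: power_add add_Suc_right)
  have 3: "durfee_cert N t =
      fps_X ^ (t * v) * (1 - fps_X ^ (2 * t)) * even_GF t * odd_GF (Suc (t + N))"
    by (simp add: durfee_cert_def v_def)
  have e: "Suc t * (2 * (Suc t + N) + 1) = t * v + 2 * t + (v + 2)" by (simp add: v_def algebra_simps)
  have e': "2 * Suc t = 2 * t + 2" "Suc t + N = Suc (t + N)" by simp_all
  have "durfee_cert N (Suc t) = fps_X ^ (t * v) * fps_X ^ (2 * t) * fps_X ^ (v + 2) *
      ((1 - fps_X ^ (2 * t + 2)) * even_GF (Suc t)) * odd_GF (Suc (Suc (t + N)))"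
    unfolding durfee_cert_def e by (simp only: e' power_add mult.assoc)
  then have 4: "durfee_cert N (Suc t) = fps_X ^ (t * v) * fps_X ^ (2 * t) * fps_X ^ (v + 2) *
      even_GF t * odd_GF (Suc (Suc (t + N)))"
    by (simp only: even_GF_Suc)
  \<comment> \<open>After removing the common factors, with x = q^(2t) and y = q^(v+2), this is (1 -
    y) - x = (1 - x)(1 - y) - x y.\<close>
  show ?thesis unfolding 1 2 3 4 q by algebra
qed

lemma sum_durfee_pair_cong_Suc:
  "fps_X ^ K dvd (\<Sum>t<K. durfee_pair N t) - (\<Sum>t<K. durfee_pair (Suc N) t)"
proof -
  have "(\<Sum>t<K. durfee_pair N t) - (\<Sum>t<K. durfee_pair (Suc N) t) =
      (\<Sum>t<K. durfee_cert N t - durfee_cert N (Suc t))"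
    by (simp add: durfee_pair_diff flip: sum_subtractf)
  also have "\<dots> = durfee_cert N 0 - durfee_cert N K" by (rule sum_lessThan_telescope')
  also have "\<dots> = - durfee_cert N K" by (simp add: durfee_cert_def)
  \<comment> \<open>The surviving boundary term contains q^(K(2(K+N)+1)), whose exponent is at least
    \<open>K\<close>.\<close>
  finally show ?thesis
    by (simp add: durfee_cert_def le_imp_power_dvd dvd_mult2)
qed

lemma sum_durfee_pair_cong:
  "fps_X ^ K dvd (\<Sum>t<K. durfee_pair N t) - (\<Sum>t<K. durfee_pair (N + j) t)"
proof (induction j)
  case (Suc j)
  then show ?case using dvd_diff_trans[OF Suc sum_durfee_pair_cong_Suc] by simp
qed simp

lemma durfee_GF_recurrence:
  "durfee_GF N + fps_X ^ (2 * N + 1) * durfee_GF (Suc N) = GF {x. odd x}"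
proof (rule fps_eq_if_cong)
  fix K
  let ?X = "fps_X :: int fps"
  have "?X ^ K dvd (durfee_GF N - (\<Sum>t<K. durfee_term N t)) +
      ?X ^ (2 * N + 1) * (durfee_GF (Suc N) - (\<Sum>t<K. durfee_term (Suc N) t))"
    by (intro dvd_add dvd_mult durfee_GF_cong)
  moreover have "(\<Sum>t<K. durfee_term N t) + ?X ^ (2 * N + 1) * (\<Sum>t<K. durfee_term (Suc N) t) =
      (\<Sum>t<K. durfee_pair N t)"
    by (simp only: sum_distrib_left durfee_term_add flip: sum.distrib)
  ultimately have 1: "?X ^ K dvd durfee_GF N + ?X ^ (2 * N + 1) * durfee_GF (Suc N) -
      (\<Sum>t<K. durfee_pair N t)"
    by (simp add: algebra_simps)
  \<comment> \<open>Moving the index from \<open>N\<close> to \<open>N + K\<close> makes every term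
    with \<open>t\<close> at least 1 divisible by q^K, so only \<open>t = 0\<close>
    survives.\<close>
  have 2: "?X ^ K dvd (\<Sum>t<K. durfee_pair (N + K) t) - odd_GF (Suc (N + K))"
  proof (cases K)
    case (Suc k)
    have "(\<Sum>t<K. durfee_pair (N + K) t) - odd_GF (Suc (N + K)) =
        (\<Sum>t<k. durfee_pair (N + K) (Suc t))"
      unfolding Suc sum.lessThan_Suc_shift by (simp add: durfee_pair_def even_GF_0[simplified])
    moreover have "?X ^ K dvd durfee_pair (N + K) (Suc t)" for t
      by (simp add: durfee_pair_def le_imp_power_dvd dvd_mult2)
    ultimately show ?thesis by (simp add: dvd_sum)
  qed simp
  have "GF {x. odd x} = odd_GF (Suc (N + K)) * GF {x. odd x \<and> 2 * Suc (N + K) \<le> x}"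
    by (subst GF_Un[symmetric]) (auto intro!: arg_cong[where f = "\<lambda>I. GF I"] odd_pos)
  then have "odd_GF (Suc (N + K)) - GF {x. odd x} =
      - (odd_GF (Suc (N + K)) * (GF {x. odd x \<and> 2 * Suc (N + K) \<le> x} - 1))"
    by (simp add: algebra_simps)
  moreover have "?X ^ K dvd GF {x. odd x \<and> 2 * Suc (N + K) \<le> x} - 1"
    by (rule GF_cong_1) auto
  ultimately have 3: "?X ^ K dvd odd_GF (Suc (N + K)) - GF {x. odd x}"
    by simp
  show "?X ^ K dvd durfee_GF N + ?X ^ (2 * N + 1) * durfee_GF (Suc N) - GF {x. odd x}"
    by (rule dvd_diff_trans[OF 1 dvd_diff_trans[OF sum_durfee_pair_cong dvd_diff_trans[OF 2 3]]])
qed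

subsection \<open>Euler's expansion of the infinite product\<close>

abbreviation init_GF :: "nat \<Rightarrow> int fps" where
  "init_GF k \<equiv> GF {0<..k}"

lemma init_GF_Suc: "(1 - fps_X ^ Suc k) * init_GF (Suc k) = init_GF k"
proof -
  have *: "{0<..Suc k} = insert (Suc k) {0<..k}" by auto
  show ?thesis unfolding * by (rule GF_insert) auto
qed

text \<open>For z = q^m this is the term (-1)^k z^k q^(k(k-1)/2) / (q;q)_k of Euler's series for
  (z;q)_infinity, whose reciprocal is \<open>GF {m..}\<close> when m is at least 1.\<close>

definition euler_term :: "nat \<Rightarrow> nat \<Rightarrow> int fps" where
  "euler_term m k = (-1) ^ k * fps_X ^ (k * (k - 1) div 2 + k * m) * init_GF k"

lemma euler_term_0 [simp]: "euler_term m 0 = 1"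
  by (simp add: euler_term_def)

text \<open>Passing from z to zq multiplies the term of index k + 1 by q^(k+1), so the difference
  has the factor 1 - q^(k+1), which cancels the last factor of (q;q)_(k+1).\<close>

lemma euler_term_Suc:
  "euler_term m (Suc k) - euler_term (Suc m) (Suc k) = - (fps_X ^ m * euler_term (Suc m) k)"
proof -
  have "k * (k - 1) div 2 + k = Suc k * k div 2"
    by (cases k) (simp_all add: algebra_simps)
  then have 1: "Suc k * (Suc k - 1) div 2 + Suc k * m = (k * (k - 1) div 2 + k * Suc m) + m"
    by simp
  then have 2: "Suc k * (Suc k - 1) div 2 + Suc k * Suc m =
      (k * (k - 1) div 2 + k * Suc m) + m + Suc k"
    by simp
  show ?thesis
    unfolding euler_term_def 1 2 init_GF_Suc[of k, symmetric] power_add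
    by (simp add: algebra_simps)
qed

text \<open>Truncation of the functional equation f(z) = (1 - z) f(zq) at z = q^m. The error is the
  single term of index \<open>K\<close>, which is divisible by q^K.\<close>

lemma euler_sum_cong_Suc:
  assumes "m \<ge> 1"
  shows "fps_X ^ K dvd (\<Sum>k<Suc K. euler_term m k) -
    (1 - fps_X ^ m) * (\<Sum>k<Suc K. euler_term (Suc m) k)"
proof -
  have "(\<Sum>k<Suc K. euler_term m k) - (\<Sum>k<Suc K. euler_term (Suc m) k) =
      (\<Sum>k<K. euler_term m (Suc k) - euler_term (Suc m) (Suc k))"
    unfolding sum.lessThan_Suc_shift by (simp add: sum_subtractf)
  also have "\<dots> = - (fps_X ^ m * (\<Sum>k<K. euler_term (Suc m) k))"
    by (simp only: euler_term_Suc sum_distrib_left sum_negf)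
  finally have "(\<Sum>k<Suc K. euler_term m k) - (1 - fps_X ^ m) * (\<Sum>k<Suc K. euler_term (Suc m) k) =
      fps_X ^ m * euler_term (Suc m) K"
    by (simp add: algebra_simps)
  then show ?thesis
    by (simp add: euler_term_def le_imp_power_dvd dvd_mult dvd_mult2)
qed

text \<open>By the functional equation the product is unchanged modulo q^K when \<open>m\<close>
  grows by one; at \<open>m + K\<close> both factors are congruent to 1.\<close>

lemma euler_cong_1:
  assumes "m \<ge> 1"
  shows "fps_X ^ K dvd (\<Sum>k<Suc K. euler_term m k) * GF {m..} - 1"
proof -
  have G: "(1 - fps_X ^ m) * GF {m..} = GF {Suc m..}" if "m \<ge> 1" for m
  proof -
    have *: "{m..} = insert m {Suc m..}" by auto
    show ?thesis unfolding * using that by (intro GF_insert) auto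
  qed
  have step: "fps_X ^ K dvd (\<Sum>k<Suc K. euler_term m k) * GF {m..} -
      (\<Sum>k<Suc K. euler_term (m + j) k) * GF {m + j..}" for j
  proof (induction j)
    case (Suc j)
    have "fps_X ^ K dvd ((\<Sum>k<Suc K. euler_term (m + j) k) -
        (1 - fps_X ^ (m + j)) * (\<Sum>k<Suc K. euler_term (Suc (m + j)) k)) * GF {m + j..}"
      using assms by (intro dvd_mult2 euler_sum_cong_Suc) auto
    also have "\<dots> = (\<Sum>k<Suc K. euler_term (m + j) k) * GF {m + j..} -
        (\<Sum>k<Suc K. euler_term (Suc (m + j)) k) * ((1 - fps_X ^ (m + j)) * GF {m + j..})"
      by algebra
    also have "(1 - fps_X ^ (m + j)) * GF {m + j..} = GF {Suc (m + j)..}"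
      using assms by (intro G) auto
    finally show ?case using dvd_diff_trans[OF Suc] by simp
  qed simp
  have "fps_X ^ K dvd euler_term (m + K) (Suc k)" for k
    by (simp add: euler_term_def le_imp_power_dvd dvd_mult dvd_mult2)
  then have "fps_X ^ K dvd (\<Sum>k<K. euler_term (m + K) (Suc k))" by (simp add: dvd_sum)
  then have "fps_X ^ K dvd (\<Sum>k<Suc K. euler_term (m + K) k) - 1"
    unfolding sum.lessThan_Suc_shift by simp
  moreover have "fps_X ^ K dvd GF {m + K..} - 1"
    using assms by (intro GF_cong_1) auto
  ultimately have "fps_X ^ K dvd ((\<Sum>k<Suc K. euler_term (m + K) k) - 1) * GF {m + K..} +
      (GF {m + K..} - 1)"
    by (intro dvd_add dvd_mult2)
  then have "fps_X ^ K dvd (\<Sum>k<Suc K. euler_term (m + K) k) * GF {m + K..} - 1"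
    by (simp add: algebra_simps)
  with step[of K] show ?thesis by (rule dvd_diff_trans)
qed

text \<open>The even and odd parts together form an initial segment of the positive integers, and
  the exponents t(2t+1) and 1 + t(2t+3) are both k(k+1)/2, for k = 2t and k = 2t + 1.\<close>

lemma durfee_term_eq_euler_term:
  "durfee_term 0 t = euler_term 1 (2 * t)"
  "fps_X * durfee_term 1 t = - euler_term 1 (Suc (2 * t))"
proof -
  have *: "{0<..2 * t} = {x. even x \<and> 0 < x \<and> x \<le> 2 * t} \<union> {x. odd x \<and> x < 2 * t}"
    by (rule set_eqI, unfold Un_iff mem_Collect_eq greaterThanAtMost_iff) presburger
  have 1: "init_GF (2 * t) = even_GF t * odd_GF t"
    unfolding * by (rule GF_Un) (auto intro: odd_pos)
  have *: "{0<..Suc (2 * t)} = {x. even x \<and> 0 < x \<and> x \<le> 2 * t} \<union> {x. odd x \<and> x < 2 * Suc t}"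
    by (rule set_eqI, unfold Un_iff mem_Collect_eq greaterThanAtMost_iff) presburger
  have 2: "init_GF (Suc (2 * t)) = even_GF t * odd_GF (Suc t)"
    unfolding * by (rule GF_Un) (auto intro: odd_pos)
  have "2 * t * (2 * t - 1) div 2 + 2 * t * 1 = t * (2 * t + 1)"
    by (cases t) (simp_all add: algebra_simps)
  then show "durfee_term 0 t = euler_term 1 (2 * t)"
    unfolding durfee_term_def euler_term_def 1 by (simp add: mult.assoc)
  have "Suc (2 * t) * (Suc (2 * t) - 1) div 2 + Suc (2 * t) * 1 = Suc (t * (2 * (t + 1) + 1))"
    by (simp add: algebra_simps)
  then show "fps_X * durfee_term 1 t = - euler_term 1 (Suc (2 * t))"
    unfolding durfee_term_def euler_term_def 2 by (simp add: mult.assoc)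
qed

lemma durfee_GF_diff: "(durfee_GF 0 - fps_X * durfee_GF 1) * GF {0<..} = 1"
proof (rule fps_eq_if_cong)
  fix K
  let ?X = "fps_X :: int fps"
  have e: "durfee_term 0 t - fps_X * durfee_term 1 t = euler_term 1 (2 * t) + euler_term 1 (Suc (2 * t))"
    for t by (simp only: durfee_term_eq_euler_term diff_minus_eq_add)
  have s: "(\<Sum>t<k. durfee_term 0 t) - ?X * (\<Sum>t<k. durfee_term 1 t) = (\<Sum>k<2 * k. euler_term 1 k)" for k
    unfolding sum_distrib_left sum_subtractf[symmetric] e by (induction k) auto
  \<comment> \<open>Taking \<open>Suc K\<close> terms of each series gives
    \<open>Suc (2 * K + 1)\<close> Euler terms, the shape that \<open>euler_cong_1\<close>
    provides.\<close>
  have "?X ^ Suc K dvd (durfee_GF 0 - (\<Sum>t<Suc K. durfee_term 0 t)) -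
      ?X * (durfee_GF 1 - (\<Sum>t<Suc K. durfee_term 1 t))"
    by (intro dvd_diff dvd_mult durfee_GF_cong)
  also have "\<dots> = durfee_GF 0 - ?X * durfee_GF 1 - (\<Sum>k<2 * Suc K. euler_term 1 k)"
    unfolding s[symmetric] by (simp add: algebra_simps)
  finally have "?X ^ K dvd durfee_GF 0 - ?X * durfee_GF 1 - (\<Sum>k<2 * Suc K. euler_term 1 k)"
    by (rule power_le_dvd) simp
  then have "?X ^ K dvd (durfee_GF 0 - ?X * durfee_GF 1 - (\<Sum>k<2 * Suc K. euler_term 1 k)) * GF {0<..}"
    by (rule dvd_mult2)
  then have 1: "?X ^ K dvd (durfee_GF 0 - ?X * durfee_GF 1) * GF {0<..} -
      (\<Sum>k<2 * Suc K. euler_term 1 k) * GF {0<..}"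
    by (simp only: left_diff_distrib)
  have *: "{1..} = {0::nat<..}" by auto
  have "?X ^ (2 * K + 1) dvd (\<Sum>k<Suc (2 * K + 1). euler_term 1 k) * GF {1..} - 1"
    by (rule euler_cong_1) simp
  then have "?X ^ K dvd (\<Sum>k<Suc (2 * K + 1). euler_term 1 k) * GF {0<..} - 1"
    unfolding * by (rule power_le_dvd) simp
  then have "?X ^ K dvd (\<Sum>k<2 * Suc K. euler_term 1 k) * GF {0<..} - 1" by simp
  with 1 show "?X ^ K dvd (durfee_GF 0 - ?X * durfee_GF 1) * GF {0<..} - 1"
    by (rule dvd_diff_trans)
qed


subsection \<open>Counting functions as coefficients\<close>

lemma gf_part_lists: "gf sum_list part_lists = GF {0<..}"
  by (rule gf_bij[OF bij_mset_part_lists, symmetric]) (simp add: sum_mset_sum_list)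

lemma bipartitions_eq: "bipartitions n =
    {z \<in> part_lists \<times> part_lists. (case z of (xs, ys) \<Rightarrow> sum_list xs + sum_list ys) = n}"
  by (auto simp: bipartitions_def partitions_eq)

lemma pp_eq_nth: "int (pp n) = (GF {0<..} * GF {0<..}) $ n"
proof -
  have "int (pp n) = gf (\<lambda>(xs, ys). sum_list xs + sum_list ys) (part_lists \<times> part_lists) $ n"
    by (simp add: pp_def bipartitions_eq)
  then show ?thesis by (simp only: gf_Times finite_part_lists gf_part_lists)
qed

text \<open>Doubling every part gives the even case. This is the source of p(n) in the identity for
  2n and of its absence in the one for 2n + 1.\<close>

lemma even_parts_nth:
  "GF {x. even x \<and> 0 < x} $ (2 * n) = int (p n)"
  "GF {x. even x \<and> 0 < x} $ (2 * n + 1) = 0"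
proof -
  have ev: "even (sum_mset M)" if "M \<in> parts {x. even x \<and> 0 < x}" for M
    using that by (induction M) (auto simp: parts_def)
  then have "{M \<in> parts {x. even x \<and> 0 < x}. sum_mset M = 2 * n + 1} = {}" by fastforce
  then show "GF {x. even x \<and> 0 < x} $ (2 * n + 1) = 0" by (simp only: gf_nth) simp
  have sum: "sum_mset (image_mset ((*) 2) M) = 2 * sum_mset M" for M :: "nat multiset"
    by (induction M) auto
  have "bij_betw (image_mset ((*) 2)) (parts {0<..}) (parts {x. even x \<and> 0 < x})"
  proof (rule bij_betw_byWitness[where f' = "image_mset (\<lambda>x. x div 2)"])
    have "image_mset (\<lambda>x. 2 * (x div 2)) M = image_mset (\<lambda>x. x) M"
      if "M \<in> parts {x. even x \<and> 0 < x}" for M :: "nat multiset"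
      using that by (intro image_mset_cong) (auto simp: parts_def)
    then show "\<forall>M\<in>parts {x. even x \<and> 0 < x}. image_mset ((*) 2) (image_mset (\<lambda>x. x div 2) M) = M"
      by (simp add: multiset.map_comp o_def)
    show "image_mset ((*) 2) ` parts {0<..} \<subseteq> parts {x. even x \<and> 0 < x}"
      by (fastforce simp: parts_def)
    show "image_mset (\<lambda>x. x div 2) ` parts {x. even x \<and> 0 < x} \<subseteq> parts {0<..}"
      by (fastforce simp: parts_def)
  qed (auto simp: multiset.map_comp o_def)
  then have "gf sum_mset (parts {x. even x \<and> 0 < x}) = gf (\<lambda>M. 2 * sum_mset M) (parts {0<..})"
    by (rule gf_bij) (rule sum)
  then have "GF {x. even x \<and> 0 < x} $ (2 * n) = GF {0<..} $ n" by simp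
  also have "\<dots> = int (p n)"
    by (simp add: p_def partitions_eq flip: gf_part_lists)
  finally show "GF {x. even x \<and> 0 < x} $ (2 * n) = int (p n)" .
qed

section \<open>From Durfee rectangles of lists to the series of \<open>pp_e\<close>\<close>

lemma nth_ge_iff_less_length_filter:
  fixes c :: "'a::linorder"
  assumes "sorted_wrt (\<ge>) xs" "i < length xs"
  shows "c \<le> xs ! i \<longleftrightarrow> i < length (filter (\<lambda>x. c \<le> x) xs)"
  using assms
proof (induction xs arbitrary: i)
  case (Cons x xs)
  show ?case
  proof (cases "c \<le> x")
    case True
    then show ?thesis using Cons by (cases i) auto
  next
    case False
    then have "\<forall>y\<in>set (x # xs). \<not> c \<le> y" using Cons.prems(1) by fastforce
    moreover from this have "filter (\<lambda>y. c \<le> y) (x # xs) = []" by (simp only: filter_empty_conv)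
    ultimately show ?thesis using nth_mem[OF Cons.prems(2)] by auto
  qed
qed simp

text \<open>Let \<open>c s\<close> count the rows with at least \<open>s + \<nu> + 2\<close> boxes.
  The height \<open>d\<close> is the greatest \<open>s\<close> with \<open>s \<le> c s\<close>, and
  the condition on the lower rows means \<open>c d \<le> d\<close>, so \<open>c d = d\<close>.
  Conversely a fixed point \<open>t\<close> satisfies \<open>t \<le> d\<close>, and since
  \<open>c\<close> is antitone, \<open>c d \<le> c t = t \<le> d\<close>.\<close>

lemma durfee_height_condition_iff:
  assumes "xs \<in> part_lists"
  shows "(\<forall>i. durfee_height 1 2 \<nu> xs < i \<and> i \<le> length xs \<longrightarrow>
      row_length 1 2 (xs ! (i - 1)) < durfee_height 1 2 \<nu> xs + \<nu> + 2) \<longleftrightarrow>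
    (\<exists>t. length (filter (\<lambda>x. 2 * (t + (\<nu> + 1)) + 1 \<le> x) xs) = t)"
proof -
  define c where "c s = length (filter (\<lambda>x. 2 * (s + (\<nu> + 1)) + 1 \<le> x) xs)" for s
  define d where "d = durfee_height 1 2 \<nu> xs"
  have c_le: "c s \<le> length xs" for s by (simp add: c_def)
  have c_anti: "c s \<le> c r" if "r \<le> s" for r s
  proof -
    have "filter (\<lambda>x. 2 * (s + (\<nu> + 1)) + 1 \<le> x) xs =
        filter (\<lambda>x. 2 * (s + (\<nu> + 1)) + 1 \<le> x) (filter (\<lambda>x. 2 * (r + (\<nu> + 1)) + 1 \<le> x) xs)"
      using that by (auto intro!: filter_cong)
    then show ?thesis unfolding c_def by (metis length_filter_le)
  qed
  have row: "s + \<nu> + 2 \<le> row_length 1 2 (xs ! (i - 1)) \<longleftrightarrow> i \<le> c s"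
    if "0 < i" "i \<le> length xs" for i s
  proof -
    have "s + \<nu> + 2 \<le> row_length 1 2 (xs ! (i - 1)) \<longleftrightarrow> 2 * (s + (\<nu> + 1)) + 1 \<le> xs ! (i - 1)"
      \<comment> \<open>This also covers a part 0, to which truncated subtraction assigns one box:
        the bound on the left is at least 2.\<close>
      unfolding row_length_def by presburger
    also have "\<dots> \<longleftrightarrow> i - 1 < c s"
      unfolding c_def using assms that
      by (intro nth_ge_iff_less_length_filter) (auto simp: part_lists_def)
    finally show ?thesis using that by auto
  qed
  have "{t. t \<le> length xs \<and> (t = 0 \<or> row_length 1 2 (xs ! (t - 1)) \<ge> t + \<nu> + 2)} = {t. t \<le> c t}"
  proof (intro Collect_cong)
    fix t
    show "t \<le> length xs \<and> (t = 0 \<or> row_length 1 2 (xs ! (t - 1)) \<ge> t + \<nu> + 2) \<longleftrightarrow> t \<le> c t"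
      using row[of t t] c_le[of t] by (cases "t = 0") auto
  qed
  then have d: "d = Max {t. t \<le> c t}" by (simp add: d_def durfee_height_def)
  have "{t. t \<le> c t} \<subseteq> {..length xs}" using c_le order_trans by blast
  then have fin: "finite {t. t \<le> c t}" by (rule finite_subset) simp
  have "0 \<in> {t. t \<le> c t}" by simp
  then have d_le: "d \<le> c d" using Max_in[OF fin] unfolding d by blast
  have "(\<forall>i. d < i \<and> i \<le> length xs \<longrightarrow> row_length 1 2 (xs ! (i - 1)) < d + \<nu> + 2) \<longleftrightarrow> c d \<le> d"
  proof
    assume L: "\<forall>i. d < i \<and> i \<le> length xs \<longrightarrow> row_length 1 2 (xs ! (i - 1)) < d + \<nu> + 2"
    show "c d \<le> d"
    proof (rule ccontr)
      assume "\<not> c d \<le> d"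
      then show False using L[rule_format, of "c d"] row[of "c d" d] c_le[of d] by simp
    qed
  next
    assume R: "c d \<le> d"
    show "\<forall>i. d < i \<and> i \<le> length xs \<longrightarrow> row_length 1 2 (xs ! (i - 1)) < d + \<nu> + 2"
    proof (intro allI impI)
      fix i assume "d < i \<and> i \<le> length xs"
      then show "row_length 1 2 (xs ! (i - 1)) < d + \<nu> + 2" using row[of i d] R by linarith
    qed
  qed
  also have "\<dots> \<longleftrightarrow> (\<exists>t. c t = t)"
  proof
    assume "\<exists>t. c t = t"
    then obtain t where t: "c t = t" ..
    then have "t \<le> d" unfolding d using fin by (intro Max_ge) auto
    then have "c d \<le> c t" by (rule c_anti)
    then show "c d \<le> d" using t \<open>t \<le> d\<close> by simp
  qed (use d_le in auto)
  finally show ?thesis by (simp only: c_def d_def)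
qed

definition M_msets :: "nat \<Rightarrow> nat multiset set" where
  "M_msets N = {M \<in> (\<Union>t. durfee_set N t). {x. odd x \<and> x < 2 * N} \<subseteq> set_mset M}"

lemma M_partitions_iff:
  assumes "xs \<in> part_lists"
  shows "xs \<in> M_partitions 1 2 \<nu> (sum_list xs) \<longleftrightarrow> mset xs \<in> M_msets (\<nu> + 1)"
proof -
  have "(\<forall>j\<le>\<nu>. 1 + 2 * j \<in> set xs) \<longleftrightarrow> {x. odd x \<and> x < 2 * (\<nu> + 1)} \<subseteq> set xs"
  proof
    assume "\<forall>j\<le>\<nu>. 1 + 2 * j \<in> set xs"
    then show "{x. odd x \<and> x < 2 * (\<nu> + 1)} \<subseteq> set xs" by (auto elim!: oddE)
  qed auto
  moreover have "[x = 1] (mod 2) \<longleftrightarrow> odd x" for x :: nat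
    by (auto simp: cong_def odd_iff_mod_2_eq_one)
  moreover have "xs \<in> partitions (sum_list xs)" using assms by (simp add: partitions_eq)
  ultimately show ?thesis
    unfolding M_partitions_def M_msets_def mem_Collect_eq durfee_height_condition_iff[OF assms]
    by (auto simp: durfee_set_def parts_def simp flip: mset_filter)
qed

lemma sum_odd_below: "\<Sum>{x::nat. odd x \<and> x < 2 * N} = N\<^sup>2"
proof (induction N)
  case (Suc N)
  have *: "{x. odd x \<and> x < 2 * Suc N} = insert (2 * N + 1) {x. odd x \<and> x < 2 * N}"
    by (auto; presburger)
  show ?case unfolding * by (subst sum.insert) (auto simp: Suc power2_eq_square)
qed simp

text \<open>One copy of each odd number below \<open>2 * N\<close> has total N^2 and lies below
  every threshold \<open>2 * (t + N) + 1\<close>, so adding or removing these copies preserves the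
  Durfee condition.\<close>

lemma gf_M_msets: "gf sum_mset (M_msets N) = fps_X ^ N\<^sup>2 * durfee_GF N"
proof -
  define B where "B = mset_set {x. odd x \<and> x < 2 * N}"
  have set_B: "set_mset B = {x. odd x \<and> x < 2 * N}" unfolding B_def by simp
  have B_sub: "B \<subseteq># M" if "{x. odd x \<and> x < 2 * N} \<subseteq> set_mset M" for M
  proof -
    have "B \<subseteq># mset_set (set_mset M)"
      unfolding B_def using that by (intro subset_imp_msubset_mset_set) auto
    then show ?thesis using mset_set_set_mset_msubset subset_mset.order_trans by blast
  qed
  have filter_B: "filter_mset (\<lambda>x. 2 * (t + N) + 1 \<le> x) B = {#}" for t
    by (auto simp: set_B)
  have add_B: "M + B \<in> durfee_set N t \<longleftrightarrow> M \<in> durfee_set N t" for M t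
    unfolding durfee_set_def mem_Collect_eq filter_union_mset filter_B
    by (auto simp: parts_def set_B)
  have "bij_betw (\<lambda>M. M + B) (\<Union>t. durfee_set N t) (M_msets N)"
  proof (rule bij_betw_byWitness[where f' = "\<lambda>M. M - B"])
    show "\<forall>M\<in>M_msets N. M - B + B = M"
      using B_sub by (auto simp: M_msets_def subset_mset.diff_add)
    then show "(\<lambda>M. M - B) ` M_msets N \<subseteq> (\<Union>t. durfee_set N t)"
      using add_B by (fastforce simp: M_msets_def)
    show "(\<lambda>M. M + B) ` (\<Union>t. durfee_set N t) \<subseteq> M_msets N"
      using add_B by (auto simp: M_msets_def set_B)
  qed auto
  moreover have "sum_mset (M + B) = sum_mset M + N\<^sup>2" for M
    unfolding B_def using sum_odd_below[of N] by (simp add: sum_unfold_sum_mset)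
  ultimately show ?thesis unfolding durfee_GF_def by (intro gf_bij_shift)
qed

lemma pp_e_eq_nth: "int (pp_e \<nu> n) =
  (GF {0<..} * GF {x. even x \<and> 0 < x} * fps_X ^ (\<nu> + 1)\<^sup>2 * durfee_GF (\<nu> + 1)) $ n"
proof -
  define Y where "Y = {ys \<in> part_lists. filter odd ys \<in> M_partitions 1 2 \<nu> (sum_list (filter odd ys))}"
  have sum: "sum_list (filter even ys) + sum_list (filter odd ys) = sum_list ys" for ys :: "nat list"
    by (induction ys) auto
  have "{(\<pi>1, \<pi>2) \<in> bipartitions n. filter odd \<pi>2 \<in>
      M_partitions 1 2 \<nu> (n - sum_list \<pi>1 - sum_list (filter even \<pi>2))} =
      {z \<in> part_lists \<times> Y. (case z of (xs, ys) \<Rightarrow> sum_list xs + sum_list ys) = n}"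
  proof -
    \<comment> \<open>For a bipartition of \<open>n\<close> the truncated differences are exact and
      equal the sum of the odd parts of \<open>ys\<close>, which removes \<open>n\<close> from the
      condition.\<close>
    have key: "(sum_list xs + sum_list ys = n \<and> filter odd ys \<in>
        M_partitions 1 2 \<nu> (n - sum_list xs - sum_list (filter even ys))) \<longleftrightarrow>
      (sum_list xs + sum_list ys = n \<and> filter odd ys \<in> M_partitions 1 2 \<nu> (sum_list (filter odd ys)))"
      for xs ys
    proof (rule conj_cong[OF refl])
      assume "sum_list xs + sum_list ys = n"
      then have "n - sum_list xs - sum_list (filter even ys) = sum_list (filter odd ys)"
        using sum[of ys] by linarith
      then show "filter odd ys \<in> M_partitions 1 2 \<nu> (n - sum_list xs - sum_list (filter even ys)) \<longleftrightarrow>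
          filter odd ys \<in> M_partitions 1 2 \<nu> (sum_list (filter odd ys))"
        by (simp only:)
    qed
    show ?thesis
    proof (rule set_eqI)
      fix z
      show "z \<in> {(\<pi>1, \<pi>2) \<in> bipartitions n. filter odd \<pi>2 \<in>
            M_partitions 1 2 \<nu> (n - sum_list \<pi>1 - sum_list (filter even \<pi>2))} \<longleftrightarrow>
          z \<in> {z \<in> part_lists \<times> Y. (case z of (xs, ys) \<Rightarrow> sum_list xs + sum_list ys) = n}"
        using key[of "fst z" "snd z"]
        unfolding bipartitions_eq Y_def split_def mem_Collect_eq mem_Times_iff fst_conv snd_conv
        by blast
    qed
  qed
  then have "int (pp_e \<nu> n) = gf (\<lambda>(xs, ys). sum_list xs + sum_list ys) (part_lists \<times> Y) $ n"
    by (simp add: pp_e_def)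
  also have "gf (\<lambda>(xs, ys). sum_list xs + sum_list ys) (part_lists \<times> Y) =
      gf sum_list part_lists * gf sum_list Y"
  proof (rule gf_Times)
    show "finite {ys \<in> Y. sum_list ys = n}" for n
      by (rule finite_subset[OF _ finite_part_lists[of n]]) (auto simp: Y_def)
  qed (rule finite_part_lists)
  also have "gf sum_list Y = GF {x. even x \<and> 0 < x} * gf sum_mset (M_msets (\<nu> + 1))"
  proof -
    let ?E = "{x::nat. even x \<and> 0 < x}" and ?O = "{x::nat. odd x}"
    define T where "T = {M \<in> parts {0<..}. filter_mset odd M \<in> M_msets (\<nu> + 1)}"
    have mem: "ys \<in> Y \<longleftrightarrow> mset ys \<in> T" if "ys \<in> part_lists" for ys
    proof -
      have "filter odd ys \<in> part_lists"
        using that by (auto simp: part_lists_def sorted_wrt_filter)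
      moreover have "mset ys \<in> parts {0<..}" using that by (auto simp: part_lists_def parts_def)
      ultimately show ?thesis using that M_partitions_iff by (simp add: Y_def T_def)
    qed
    have "Y = {ys \<in> part_lists. mset ys \<in> T}" using mem by (auto simp: Y_def)
    moreover have "T = mset ` {ys \<in> part_lists. mset ys \<in> T}"
      using bij_mset_part_lists by (auto simp: T_def bij_betw_def)
    ultimately have "bij_betw mset Y T"
      using bij_mset_part_lists by (auto simp: bij_betw_def intro: inj_on_subset)
    then have "gf sum_mset T = gf sum_list Y"
      by (rule gf_bij) (simp add: sum_mset_sum_list)
    moreover have "?E \<union> ?O = {0<..}" by (auto intro: odd_pos)
    then have "T = {M \<in> parts (?E \<union> ?O). filter_mset (\<lambda>x. x \<in> ?E) M \<in> parts ?E \<and>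
        filter_mset (\<lambda>x. x \<in> ?O) M \<in> M_msets (\<nu> + 1)}"
      by (auto simp: T_def parts_def)
    moreover have "gf sum_mset {M \<in> parts (?E \<union> ?O). filter_mset (\<lambda>x. x \<in> ?E) M \<in> parts ?E \<and>
        filter_mset (\<lambda>x. x \<in> ?O) M \<in> M_msets (\<nu> + 1)} = GF ?E * gf sum_mset (M_msets (\<nu> + 1))"
      by (rule gf_parts_Un) (auto simp: M_msets_def durfee_set_def intro: odd_pos)
    ultimately show ?thesis by simp
  qed
  finally show ?thesis by (simp only: gf_part_lists gf_M_msets mult.assoc)
qed

text \<open>Treating both parities at once and allowing \<nu> = 0 makes the induction start. In the
  notation of the overview, \<open>pp_e \<nu> m\<close> is the coefficient of \<open>Y\<close> with
  index \<nu> + 1. The base case adds Y_0 + Y_1 = P^2 and Y_0 - Y_1 = E in the form P^2 = E + 2 Y_1;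
  each step uses the relation between consecutive \<open>Y\<close>.\<close>

lemma truncated_theta_sum:
  assumes "\<nu>\<^sup>2 \<le> m"
  shows "int (pp m) + 2 * (\<Sum>\<tau>=1..\<nu>. (-1) ^ \<tau> * int (pp (m - \<tau>\<^sup>2))) =
    GF {x. even x \<and> 0 < x} $ m + 2 * (-1) ^ \<nu> * int (pp_e \<nu> m)"
  using assms
proof (induction \<nu>)
  let ?P = "GF {0<..}" and ?E = "GF {x. even x \<and> 0 < x}" and ?O = "GF {x. odd x}"
  have "{0<..} = {x::nat. even x \<and> 0 < x} \<union> {x. odd x}" by (auto intro: odd_pos)
  then have P: "?P = ?E * ?O" by (simp only:, intro GF_Un) (auto intro: odd_pos)
  {
    case 0
    have "?P * ?P = ?P * ?E * (durfee_GF 0 + fps_X * durfee_GF 1)"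
      using durfee_GF_recurrence[of 0] P by (simp add: algebra_simps)
    also have "\<dots> = ?E * ((durfee_GF 0 - fps_X * durfee_GF 1) * ?P) + 2 * (?P * ?E * fps_X * durfee_GF 1)"
      by algebra
    also have "\<dots> = ?E + (?P * ?E * fps_X * durfee_GF 1 + ?P * ?E * fps_X * durfee_GF 1)"
      unfolding durfee_GF_diff by simp
    finally have "int (pp m) = ?E $ m + ((?P * ?E * fps_X * durfee_GF 1) $ m + (?P * ?E * fps_X * durfee_GF 1) $ m)"
      unfolding pp_eq_nth by (simp only: fps_add_nth)
    moreover have "int (pp_e 0 m) = (?P * ?E * fps_X * durfee_GF 1) $ m"
      using pp_e_eq_nth[of 0 m] by simp
    ultimately show ?case by simp
  next
    case (Suc \<nu>)
    let ?N = "\<nu> + 1"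
    have "fps_X ^ ?N\<^sup>2 * (?P * ?P) =
        ?P * ?E * fps_X ^ ?N\<^sup>2 * (durfee_GF ?N + fps_X ^ (2 * ?N + 1) * durfee_GF (Suc ?N))"
      unfolding durfee_GF_recurrence by (subst (2) P) (simp add: algebra_simps)
    also have "\<dots> = ?P * ?E * fps_X ^ ?N\<^sup>2 * durfee_GF ?N +
        ?P * ?E * fps_X ^ (?N\<^sup>2 + (2 * ?N + 1)) * durfee_GF (Suc ?N)"
      unfolding power_add[of _ "?N\<^sup>2" "2 * ?N + 1"] by (simp only: algebra_simps)
    also have "?N\<^sup>2 + (2 * ?N + 1) = (Suc \<nu> + 1)\<^sup>2" by (simp add: power2_eq_square)
    finally have "(fps_X ^ ?N\<^sup>2 * (?P * ?P)) $ m = int (pp_e \<nu> m) + int (pp_e (Suc \<nu>) m)"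
      by (simp only: pp_e_eq_nth fps_add_nth) simp
    \<comment> \<open>The bound on \<open>m\<close> ensures that the shifted coefficient is not one
      of the vanishing low ones.\<close>
    moreover have "(fps_X ^ ?N\<^sup>2 * (?P * ?P)) $ m = int (pp (m - ?N\<^sup>2))"
      using Suc.prems unfolding fps_X_power_mult_nth pp_eq_nth by simp
    ultimately have "int (pp (m - (Suc \<nu>)\<^sup>2)) = int (pp_e \<nu> m) + int (pp_e (Suc \<nu>) m)"
      by simp
    moreover have "\<nu>\<^sup>2 \<le> m" using Suc.prems by (simp add: power2_eq_square)
    ultimately show ?case using Suc.IH by (simp add: algebra_simps)
  }
qed

theorem theorem1p8:
  fixes \<nu> n :: nat
  assumes "\<nu> \<ge> 1" and "n \<ge> (\<nu> + 1)\<^sup>2"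
  shows "((-1) ^ \<nu> * (int (pp (2 * n)) + 2 * (\<Sum>\<tau>=1..\<nu>. (-1) ^ \<tau> * int (pp (2 * n - \<tau>\<^sup>2))))
            = (-1) ^ \<nu> * int (p n) + 2 * int (pp_e \<nu> (2 * n))) \<and>
         ((-1) ^ \<nu> * (int (pp (2 * n + 1)) + 2 * (\<Sum>\<tau>=1..\<nu>. (-1) ^ \<tau> * int (pp (2 * n + 1 - \<tau>\<^sup>2))))
            = 2 * int (pp_e \<nu> (2 * n + 1)))"
proof -
  have "\<nu>\<^sup>2 \<le> (\<nu> + 1)\<^sup>2" by (simp add: power2_eq_square)
  then have "\<nu>\<^sup>2 \<le> 2 * n" "\<nu>\<^sup>2 \<le> 2 * n + 1" using assms(2) by linarith+
  moreover have "(-1) ^ \<nu> * (2 * (-1) ^ \<nu> * k) = 2 * k" for k :: int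
    by (cases "even \<nu>") auto
  ultimately show ?thesis
    by (simp only: truncated_theta_sum even_parts_nth distrib_left) simp
qed

end
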